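(* Let $f, f_1,\ldots,f_m\in\mathbb{R}[x]=\mathbb{R}[x_1,\ldots,x_n]$, let $K=\{x\in\mathbb{R}^n : f_j(x)\ge 0,\ j=1,\ldots,m\}$, and suppose that the problem of minimizing $f$ over $K$ has an optimal solution $x^*$; let $f^*=f(x^* )$ be the optimal value and $b=\max(1,\max_i|x_i^*|)$. For $\epsilon>0$ and positive integers $r\ge\tilde r$ define $$\hat\rho(\epsilon,\tilde r,r)=\sup\Big\{\rho\in\mathbb{R} : f-\rho+\epsilon\,\Theta_{r,b}-\sum_{j=1}^m f_j\sigma_j=\sigma_0,\ \sigma_0\in\Sigma_r,\ \sigma_j\in\Sigma(\tilde r\tilde{\mathcal F}_j)\ (j=1,\ldots,m)\Big\},$$ where $\Theta_{r,b}(x)=1+\sum_{i=1}^n (x_i/b)^{2r}$. Then for every $\epsilon>0$ there exist $\tilde r, r\in\mathbb{N}$ such that $$f^*-\epsilon\ \le\ \hat\rho(\epsilon,\tilde r,r)\ \le\ f^*+\epsilon(n+1).$$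
   Context: $\Sigma$ is the set of sums of squares of real polynomials in $x_1,\dots,x_n$, and $\Sigma_r$ is the set of elements of $\Sigma$ of degree at most $2r$. The support $\mathrm{supp}(g)\subset\mathbb{N}^n$ of a polynomial $g$ is the set of exponents of monomials having nonzero coefficient in $g$. $\mathcal F_j=\mathrm{supp}(f_j)$ and $\tilde{\mathcal F}_j=\mathcal F_j\cup\{0\}$. For a finite set $\mathcal F\subset\mathbb{N}^n$ and a positive integer $r$, $r\mathcal F=\mathcal F+\cdots+\mathcal F$ ($r$-fold Minkowski sum), and $\Sigma(\mathcal F)=\{\sum_{k=1}^q g_k^2 : \mathrm{supp}(g_k)\subseteq\mathcal F\}$ is the set of (finite) sums of squares of polynomials with support in $\mathcal F$. The supremum of the empty set is $-\infty$. *)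

theory Defs
  imports "HOL-Analysis.Analysis" "HOL-Library.Poly_Mapping"
begin

text \<open>Real polynomials in finitely many variables, the variables being indexed by a finite
  type \<open>'n\<close>: finitely supported maps from exponent vectors to coefficients, with the
  convolution product of \<^theory>\<open>HOL-Library.Poly_Mapping\<close>.  The support of a polynomial
  is its set of keys.\<close>

type_synonym 'n expo = "'n \<Rightarrow>\<^sub>0 nat"
type_synonym 'n rpoly = "'n expo \<Rightarrow>\<^sub>0 real"

definition cpoly :: "real \<Rightarrow> 'n rpoly" where
  "cpoly c = Poly_Mapping.single 0 c"

definition xvar :: "'n \<Rightarrow> 'n rpoly" where
  "xvar i = Poly_Mapping.single (Poly_Mapping.single i 1) 1"

definition peval :: "'n::finite rpoly \<Rightarrow> real ^ 'n \<Rightarrow> real" where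
  "peval p x = (\<Sum>a\<in>Poly_Mapping.keys p.
     Poly_Mapping.lookup p a * (\<Prod>i\<in>UNIV. (x $ i) ^ Poly_Mapping.lookup a i))"

abbreviation supp :: "'n rpoly \<Rightarrow> 'n expo set" where
  "supp \<equiv> Poly_Mapping.keys"

definition expo_deg :: "'n::finite expo \<Rightarrow> nat" where
  "expo_deg a = (\<Sum>i\<in>UNIV. Poly_Mapping.lookup a i)"

text \<open>The zero polynomial gets degree 0, so it belongs to every \<open>sos_deg r\<close> below.\<close>

definition total_deg :: "'n::finite rpoly \<Rightarrow> nat" where
  "total_deg p = Max (insert 0 (expo_deg ` supp p))"

definition sos_supp :: "'n::finite expo set \<Rightarrow> 'n rpoly set" where
  "sos_supp F = {\<Sum>k<q. (g k)\<^sup>2 | (q :: nat) g. \<forall>k<q. supp (g k) \<subseteq> F}"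

definition sos :: "'n::finite rpoly set" where
  "sos = {\<Sum>k<q. (g k)\<^sup>2 | (q :: nat) g. True}"

definition sos_deg :: "nat \<Rightarrow> 'n::finite rpoly set" where
  "sos_deg r = {p \<in> sos. total_deg p \<le> 2 * r}"

definition minkowski_multiple :: "nat \<Rightarrow> 'a::comm_monoid_add set \<Rightarrow> 'a set" where
  "minkowski_multiple r F = {\<Sum>k<r. a k | a. \<forall>k<r. a k \<in> F}"

definition feasible_set :: "nat \<Rightarrow> (nat \<Rightarrow> 'n::finite rpoly) \<Rightarrow> (real ^ 'n) set" where
  "feasible_set m fs = {x. \<forall>j\<in>{1..m}. 0 \<le> peval (fs j) x}"

definition optimal_solution ::
    "'n::finite rpoly \<Rightarrow> (real ^ 'n) set \<Rightarrow> real ^ 'n \<Rightarrow> bool" where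
  "optimal_solution f K x \<longleftrightarrow> x \<in> K \<and> (\<forall>y\<in>K. peval f x \<le> peval f y)"

definition Theta :: "nat \<Rightarrow> real \<Rightarrow> 'n::finite rpoly" where
  "Theta r b = 1 + (\<Sum>i\<in>UNIV. (cpoly (1 / b) * xvar i) ^ (2 * r))"

text \<open>The supremum is taken in \<^typ>\<open>ereal\<close>, where the supremum of the empty set is
  \<open>-\<infinity>\<close>.\<close>

definition rho_hat :: "'n::finite rpoly \<Rightarrow> nat \<Rightarrow> (nat \<Rightarrow> 'n rpoly) \<Rightarrow> real
    \<Rightarrow> real \<Rightarrow> nat \<Rightarrow> nat \<Rightarrow> ereal" where
  "rho_hat f m fs b \<epsilon> rt r = Sup {ereal \<rho> | \<rho>.
     \<exists>\<sigma>\<^sub>0 \<sigma>. \<sigma>\<^sub>0 \<in> sos_deg r \<and>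
       (\<forall>j\<in>{1..m}. \<sigma> j \<in> sos_supp (minkowski_multiple rt (supp (fs j) \<union> {0}))) \<and>
       f - cpoly \<rho> + cpoly \<epsilon> * Theta r b - (\<Sum>j=1..m. fs j * \<sigma> j) = \<sigma>\<^sub>0}"

end

theory Submission
  imports Defs
begin

text \<open>Upper bound: evaluate the identity at \<open>xstar\<close>, where \<open>\<Theta>\<close> is at most \<open>n + 1\<close>.

  Lower bound: take \<open>\<sigma>\<^sub>j = (1 - f\<^sub>j / R)\<^bsup>2k\<^esup>\<close> with \<open>R\<close> a bound for the \<open>\<bar>f\<^sub>j\<bar>\<close> on the box
  \<open>[-b, b]\<^sup>n\<close>.  For large \<open>k\<close> the product \<open>f\<^sub>j \<sigma>\<^sub>j\<close> is uniformly small where \<open>f\<^sub>j \<ge> 0\<close> and very negative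
  where \<open>f\<^sub>j < 0\<close>, so \<open>p = f - f\<^sup>* + \<epsilon> - \<Sum>f\<^sub>j \<sigma>\<^sub>j\<close> is positive on the box.  It remains to show that
  \<open>p + \<epsilon> \<Theta>\<^sub>r\<close> is a sum of squares for large \<open>r\<close>, as in the theorem of Lasserre and Netzer.  The polynomials
  with this property for every \<open>\<epsilon> > 0\<close> form a quadratic module: each square \<open>q\<^sup>2\<close> satisfies
  \<open>q\<^sup>2 \<Theta>\<^sub>r \<preceq> C \<Theta>\<^bsub>r+d\<^esub>\<close> modulo sums of squares, with \<open>C\<close> and \<open>d\<close> independent of \<open>r\<close>.  The module
  contains \<open>1 - (x\<^sub>i / b)\<^sup>2\<close>, since \<open>1 - s + s\<^sup>r / (r - 1)\<close> is a sum of squares whenever \<open>s\<close> is a square.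
  Hence it is archimedean, and Putinar's theorem applies.\<close>

subsection \<open>Polynomial arithmetic\<close>

lemma cpoly_0 [simp]: "cpoly 0 = 0"
  and cpoly_1 [simp]: "cpoly 1 = 1"
  and cpoly_add: "cpoly (c + d) = cpoly c + cpoly d"
  and cpoly_diff: "cpoly (c - d) = cpoly c - cpoly d"
  and cpoly_minus: "cpoly (- c) = - cpoly c"
  and cpoly_mult: "cpoly (c * d) = cpoly c * cpoly d"
  and cpoly_numeral [simp]: "cpoly (numeral w) = numeral w"
  and cpoly_of_nat [simp]: "cpoly (of_nat n) = of_nat n"
  by (simp_all add: cpoly_def single_add single_diff single_uminus mult_single)

lemma cpoly_power: "cpoly (c ^ k) = cpoly c ^ k"
  by (induction k) (simp_all add: cpoly_mult)

lemmas cpoly_hom = cpoly_add cpoly_diff cpoly_minus cpoly_mult cpoly_power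

lemma update_eq_single_add:
  assumes "a \<notin> Poly_Mapping.keys p"
  shows "Poly_Mapping.update a c p = Poly_Mapping.single a c + p"
  using assms by (intro poly_mapping_eqI) (auto simp: lookup_update lookup_add lookup_single in_keys_iff)

lemma poly_mapping_single_induct [case_names zero add]:
  assumes "P 0" and "\<And>a c p. P p \<Longrightarrow> P (Poly_Mapping.single a c + p)"
  shows "P p"
proof (induction p rule: update_induct)
  case const
  show ?case by fact
next
  case (update p a c)
  then show ?case using assms(2) by (simp add: update_eq_single_add)
qed

text \<open>Constants and variables generate the polynomial algebra. Through this rule, bounds,
  infinitesimality and domination by \<open>Theta\<close> pass from the generators to all
  polynomials.\<close>

lemma rpoly_induct [case_names const var add mult]:
  fixes p :: "'n::finite rpoly"
  assumes const: "\<And>c. P (cpoly c)" and var: "\<And>i. P (xvar i)"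
    and add: "\<And>p q. P p \<Longrightarrow> P q \<Longrightarrow> P (p + q)" and mult: "\<And>p q. P p \<Longrightarrow> P q \<Longrightarrow> P (p * q)"
  shows "P p"
proof (induction p rule: poly_mapping_single_induct)
  case zero
  show ?case using const[of 0] by simp
next
  case (add a c p)
  have pow: "P (Poly_Mapping.single (Poly_Mapping.single i k) 1)" for i :: 'n and k
  proof (induction k)
    case 0
    show ?case using const[of 1] by simp
  next
    case (Suc k)
    have "Poly_Mapping.single (Poly_Mapping.single i (Suc k)) (1::real)
        = xvar i * Poly_Mapping.single (Poly_Mapping.single i k) 1"
      by (simp add: xvar_def mult_single flip: single_add)
    then show ?case using mult[OF var Suc] by simp
  qed
  \<comment> \<open>Exponent vectors are finitely supported maps too, so the same induction on
    \<open>a\<close> splits off one power of a variable at a time.\<close>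
  have "P (Poly_Mapping.single a c)"
  proof (induction a rule: poly_mapping_single_induct)
    case zero
    show ?case using const[of c] by (simp add: cpoly_def)
  next
    case (add i k a)
    have "Poly_Mapping.single (Poly_Mapping.single i k + a) c
        = Poly_Mapping.single (Poly_Mapping.single i k) 1 * Poly_Mapping.single a c"
      by (simp add: mult_single)
    then show ?case using mult[OF pow add] by simp
  qed
  then show ?case using assms(3) add by blast
qed

subsection \<open>Evaluation\<close>

lemma peval_0 [simp]: "peval 0 x = 0"
  by (simp add: peval_def)

lemma peval_single:
  "peval (Poly_Mapping.single a c) x = c * (\<Prod>i\<in>UNIV. (x $ i) ^ Poly_Mapping.lookup a i)"
  by (simp add: peval_def)

lemma peval_add: "peval (p + q) x = peval p x + peval q x"
  unfolding peval_def
  by (rule setsum_keys_plus_distrib) (simp_all add: algebra_simps)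

lemma peval_single_mult:
  "peval (Poly_Mapping.single a c * q) x = peval (Poly_Mapping.single a c) x * peval q x"
proof (induction q rule: poly_mapping_single_induct)
  case (add b d q)
  then show ?case
    by (simp add: distrib_left peval_add mult_single peval_single lookup_add power_add prod.distrib)
qed simp

lemma peval_mult: "peval (p * q) x = peval p x * peval q x"
  by (induction p rule: poly_mapping_single_induct)
    (simp_all add: distrib_right peval_add peval_single_mult)

lemma peval_cpoly [simp]: "peval (cpoly c) x = c"
  by (simp add: cpoly_def peval_single)

lemma peval_1 [simp]: "peval 1 x = 1"
  using peval_cpoly[of 1 x] by simp

lemma peval_xvar [simp]: "peval (xvar i) x = x $ i"
  unfolding xvar_def peval_single
  by (simp add: lookup_single when_def if_distrib[of "\<lambda>k. _ ^ k"] prod.delta' cong: if_cong)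

lemma peval_minus: "peval (- p) x = - peval p x"
  using peval_add[of p "- p" x] by simp

lemma peval_diff: "peval (p - q) x = peval p x - peval q x"
  using peval_add[of p "- q" x] by (simp add: peval_minus)

lemma peval_power: "peval (p ^ k) x = peval p x ^ k"
  by (induction k) (simp_all add: peval_mult)

lemma peval_sum: "peval (\<Sum>i\<in>I. p i) x = (\<Sum>i\<in>I. peval (p i) x)"
  by (induction I rule: infinite_finite_induct) (simp_all add: peval_add)

lemmas peval_hom = peval_add peval_diff peval_minus peval_mult peval_power peval_sum

lemma continuous_on_peval: "continuous_on A (peval p)"
  unfolding peval_def by (intro continuous_intros)

subsection \<open>Sums of squares\<close>

lemma sos_0 [simp]: "0 \<in> sos"
  unfolding sos_def by (auto intro!: exI[of _ 0])

lemma sos_add_square: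
  assumes "s \<in> sos"
  shows "s + p\<^sup>2 \<in> sos"
proof -
  obtain q :: nat and g where "s = (\<Sum>k<q. (g k)\<^sup>2)"
    using assms by (auto simp: sos_def)
  then have "s + p\<^sup>2 = (\<Sum>k<Suc q. ((g(q := p)) k)\<^sup>2)"
    by simp
  then show ?thesis unfolding sos_def by blast
qed

lemma sos_induct [consumes 1, case_names zero add_square]:
  assumes "s \<in> sos" and "P 0" and "\<And>s p. s \<in> sos \<Longrightarrow> P s \<Longrightarrow> P (s + p\<^sup>2)"
  shows "P s"
proof -
  have "(\<Sum>k<q. (g k)\<^sup>2) \<in> sos \<and> P (\<Sum>k<q. (g k)\<^sup>2)" for q :: nat and g
    by (induction q) (use assms in \<open>auto intro: sos_add_square\<close>)
  then show ?thesis using assms(1) by (auto simp: sos_def)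
qed

lemma sos_add:
  assumes "s \<in> sos" and "t \<in> sos"
  shows "s + t \<in> sos"
  using assms(2)
  by (induction t rule: sos_induct)
    (use assms(1) in \<open>auto simp: add.assoc[symmetric] intro: sos_add_square\<close>)

lemma sos_square [simp]: "p\<^sup>2 \<in> sos"
  using sos_add_square[OF sos_0] by simp

lemma sos_mult_square: "s \<in> sos \<Longrightarrow> p\<^sup>2 * s \<in> sos"
  by (induction s rule: sos_induct)
    (auto simp: distrib_left simp flip: power_mult_distrib intro: sos_add)

lemma sos_mult: "s \<in> sos \<Longrightarrow> t \<in> sos \<Longrightarrow> s * t \<in> sos"
  by (induction s rule: sos_induct) (auto simp: distrib_right intro: sos_add sos_mult_square)

lemma sos_cpoly: "0 \<le> c \<Longrightarrow> cpoly c \<in> sos"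
  using sos_square[of "cpoly (sqrt c)"] by (simp flip: cpoly_power)

lemma sos_1 [simp]: "1 \<in> sos"
  using sos_square[of 1] by simp

lemma sos_power: "s \<in> sos \<Longrightarrow> s ^ k \<in> sos"
  by (induction k) (auto intro: sos_mult)

lemma sos_sum: "(\<And>i. i \<in> I \<Longrightarrow> s i \<in> sos) \<Longrightarrow> (\<Sum>i\<in>I. s i) \<in> sos"
  by (induction I rule: infinite_finite_induct) (auto intro: sos_add)

lemma peval_sos_nonneg: "s \<in> sos \<Longrightarrow> 0 \<le> peval s x"
  by (induction s rule: sos_induct) (auto simp: peval_hom)

section \<open>The order given by sums of squares\<close>

definition sos_le :: "'n::finite rpoly \<Rightarrow> 'n rpoly \<Rightarrow> bool"  (infix "\<preceq>" 50)
  where "p \<preceq> q \<longleftrightarrow> q - p \<in> sos"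

lemma sos_le_refl [simp]: "p \<preceq> p"
  by (simp add: sos_le_def)

lemma sos_le_trans [trans]: "p \<preceq> q \<Longrightarrow> q \<preceq> r \<Longrightarrow> p \<preceq> r"
  unfolding sos_le_def using sos_add[of "q - p" "r - q"] by simp

lemma sos_le_add: "p \<preceq> q \<Longrightarrow> p' \<preceq> q' \<Longrightarrow> p + p' \<preceq> q + q'"
  unfolding sos_le_def using sos_add[of "q - p" "q' - p'"] by (simp add: algebra_simps)

lemma sos_le_sum: "(\<And>i. i \<in> I \<Longrightarrow> p i \<preceq> q i) \<Longrightarrow> (\<Sum>i\<in>I. p i) \<preceq> (\<Sum>i\<in>I. q i)"
  by (induction I rule: infinite_finite_induct) (auto intro: sos_le_add)

lemma sos_le_mult: "s \<in> sos \<Longrightarrow> p \<preceq> q \<Longrightarrow> s * p \<preceq> s * q"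
  unfolding sos_le_def using sos_mult[of s "q - p"] by (simp add: right_diff_distrib)

lemma sos_le_cpoly_mult: "0 \<le> c \<Longrightarrow> p \<preceq> q \<Longrightarrow> cpoly c * p \<preceq> cpoly c * q"
  by (intro sos_le_mult sos_cpoly)

text \<open>Both factors are divisible by \<open>s - t\<close>, with cofactors \<open>?Q k\<close>
  and \<open>?Q l\<close> that are sums of products of powers of \<open>s\<close> and
  \<open>t\<close>. The product is therefore \<open>(s - t)\<^sup>2\<close> times a sum of
  squares.\<close>

lemma sos_diff_power_mult:
  assumes "s \<in> sos" "t \<in> sos"
  shows "(s ^ k - t ^ k) * (s ^ l - t ^ l) \<in> sos"
proof -
  let ?Q = "\<lambda>k. \<Sum>i<k. t ^ (k - Suc i) * s ^ i"
  have "?Q k \<in> sos" for k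
    by (intro sos_sum sos_mult sos_power assms)
  then have "(s - t)\<^sup>2 * (?Q k * ?Q l) \<in> sos"
    by (intro sos_mult) auto
  moreover have "(s ^ k - t ^ k) * (s ^ l - t ^ l) = (s - t)\<^sup>2 * (?Q k * ?Q l)"
    unfolding power_diff_sumr2[of s k t] power_diff_sumr2[of s l t] power2_eq_square
    by (simp only: mult.assoc mult.left_commute)
  ultimately show ?thesis by simp
qed

text \<open>Expanding the product in \<open>sos_diff_power_mult\<close> leaves two mixed terms, and
  the unwanted one, \<open>s ^ l * t ^ k\<close>, is itself a sum of squares.\<close>

lemma power_mult_power_sos_le:
  assumes "s \<in> sos" "t \<in> sos"
  shows "s ^ k * t ^ l \<preceq> s ^ (k + l) + t ^ (k + l)"
proof -
  have "(s ^ k - t ^ k) * (s ^ l - t ^ l) + s ^ l * t ^ k \<in> sos"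
    using assms by (intro sos_add sos_diff_power_mult sos_mult sos_power)
  then show ?thesis
    by (simp add: sos_le_def algebra_simps power_add)
qed

text \<open>With \<open>t = (1 - 1 / k) s\<close> this is \<open>t\<^sup>k - k t + k - 1 = (t - 1)\<^sup>2 (\<Sum>i<k. \<Sum>j<i. t\<^sup>j)\<close>,
  divided by \<open>k - 1\<close>.\<close>

lemma one_minus_plus_power_sos:
  fixes s :: "'n::finite rpoly"
  assumes s: "s \<in> sos" and k: "2 \<le> (k::nat)"
  shows "1 - s + cpoly (1 / (real k - 1)) * s ^ k \<in> sos"
proof -
  define t where "t = cpoly ((real k - 1) / real k) * s"
  have t: "t \<in> sos" unfolding t_def using k s by (intro sos_mult sos_cpoly) auto
  have eq: "t ^ k - of_nat k * t + of_nat k - 1 = (t - 1)\<^sup>2 * (\<Sum>i<k. \<Sum>j<i. t ^ j)" for k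
  proof (induction k)
    case (Suc k)
    have g: "t ^ k - 1 = (t - 1) * (\<Sum>j<k. t ^ j)" by (rule power_diff_1_eq)
    have "t ^ Suc k - of_nat (Suc k) * t + of_nat (Suc k) - 1
        = (t ^ k - of_nat k * t + of_nat k - 1) + (t - 1) * (t ^ k - 1)"
      by (simp add: algebra_simps)
    then show ?case unfolding Suc.IH g by (simp add: algebra_simps power2_eq_square)
  qed simp
  have "(t - 1)\<^sup>2 * (\<Sum>i<k. \<Sum>j<i. t ^ j) \<in> sos"
    using t by (intro sos_mult[OF sos_square] sos_sum sos_power) auto
  then have p: "t ^ k - of_nat k * t + of_nat k - 1 \<in> sos" by (simp add: eq)
  let ?c = "1 / (real k - 1)"
  have *: "cpoly ?c * (t ^ k - of_nat k * t + of_nat k - 1) \<in> sos"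
    by (rule sos_mult[OF sos_cpoly p]) (use k in auto)
  have "cpoly ?c * (t ^ k - of_nat k * t + of_nat k - 1)
    = cpoly (?c * ((real k - 1) / real k) ^ k) * s ^ k
      - cpoly (?c * real k * ((real k - 1) / real k)) * s + cpoly (?c * (real k - 1))"
    by (simp only: t_def cpoly_hom power_mult_distrib cpoly_of_nat cpoly_1 algebra_simps)
  also have "?c * real k * ((real k - 1) / real k) = 1" using k by (simp add: field_simps)
  also have "?c * (real k - 1) = 1" using k by simp
  finally have "1 - s + cpoly (?c * ((real k - 1) / real k) ^ k) * s ^ k
      = cpoly ?c * (t ^ k - of_nat k * t + of_nat k - 1)"
    by simp
  with * have **: "1 - s + cpoly (?c * ((real k - 1) / real k) ^ k) * s ^ k \<in> sos"
    by metis
  \<comment> \<open>The coefficient of \<open>s ^ k\<close> obtained so far carries this factor.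
    Since it is at most 1, adding a sum of squares replaces it by 1.\<close>
  have "((real k - 1) / real k) ^ k \<le> 1"
    using k by (intro power_le_one) auto
  then have "cpoly (?c * (1 - ((real k - 1) / real k) ^ k)) * s ^ k \<in> sos"
    using k by (intro sos_mult sos_power s sos_cpoly) auto
  from sos_add[OF ** this] show ?thesis
    by (simp only: cpoly_hom algebra_simps cpoly_1) (simp add: algebra_simps)
qed

subsection \<open>Quadratic modules\<close>

definition quadratic_module :: "'n::finite rpoly set \<Rightarrow> bool" where
  "quadratic_module M \<longleftrightarrow>
     1 \<in> M \<and> (\<forall>p\<in>M. \<forall>q\<in>M. p + q \<in> M) \<and> (\<forall>p\<in>M. \<forall>q. q\<^sup>2 * p \<in> M)"

text \<open>A one-sided bound suffices, because the condition for \<open>- p\<close> bounds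
  \<open>p\<close> from below.\<close>

definition archimedean :: "'n::finite rpoly set \<Rightarrow> bool" where
  "archimedean M \<longleftrightarrow> (\<forall>p. \<exists>K. cpoly K - p \<in> M)"

text \<open>Modulo \<open>M\<close>, no positive constant separates such a \<open>p\<close> from 0.
  For an archimedean quadratic module these elements form an ideal.\<close>

definition infinitesimal :: "'n::finite rpoly set \<Rightarrow> 'n rpoly \<Rightarrow> bool" where
  "infinitesimal M p \<longleftrightarrow> (\<forall>e>0. cpoly e + p \<in> M \<and> cpoly e - p \<in> M)"

lemma quadratic_moduleD:
  assumes "quadratic_module M"
  shows quadratic_module_one: "1 \<in> M"
    and quadratic_module_add: "p \<in> M \<Longrightarrow> q \<in> M \<Longrightarrow> p + q \<in> M"
    and quadratic_module_square_mult: "p \<in> M \<Longrightarrow> q\<^sup>2 * p \<in> M"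
  using assms by (auto simp: quadratic_module_def)

lemma quadratic_module_sos_mult:
  assumes M: "quadratic_module M" and "s \<in> sos" and p: "p \<in> M"
  shows "s * p \<in> M"
  using assms(2)
proof (induction s rule: sos_induct)
  case zero
  show ?case using quadratic_module_square_mult[OF M p, of 0] by simp
next
  case (add_square s q)
  then show ?case
    using M p by (auto simp: distrib_right intro: quadratic_module_add quadratic_module_square_mult)
qed

lemma quadratic_module_cpoly_mult:
  "quadratic_module M \<Longrightarrow> 0 \<le> c \<Longrightarrow> p \<in> M \<Longrightarrow> cpoly c * p \<in> M"
  by (intro quadratic_module_sos_mult sos_cpoly)

lemma sos_subset_quadratic_module: "quadratic_module M \<Longrightarrow> sos \<subseteq> M"
  using quadratic_module_sos_mult[OF _ _ quadratic_module_one] by fastforce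

lemma quadratic_module_cpoly: "quadratic_module M \<Longrightarrow> 0 \<le> c \<Longrightarrow> cpoly c \<in> M"
  using sos_subset_quadratic_module sos_cpoly by blast

lemma quadratic_module_cpoly_mono:
  assumes "quadratic_module M" "cpoly c + p \<in> M" "c \<le> d"
  shows "cpoly d + p \<in> M"
  using quadratic_module_add[OF assms(1) quadratic_module_cpoly[OF assms(1)] assms(2), of "d - c"] assms(3)
  by (simp add: cpoly_diff)

text \<open>A quadratic module need not be closed under products, so the bound is reached through
  \<open>(K - p)\<^sup>2 (K + p) + (K + p)\<^sup>2 (K - p) = 2 K (K\<^sup>2 -
  p\<^sup>2)\<close>.\<close>

lemma quadratic_module_bound_square:
  assumes M: "quadratic_module M" and "cpoly K + p \<in> M" "cpoly K - p \<in> M"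
  shows "\<exists>L. cpoly L - p\<^sup>2 \<in> M"
proof -
  \<comment> \<open>\<open>K\<close> may fail to be positive; raising it to at least 1 permits the
    division by \<open>2 * K'\<close>.\<close>
  define K' where "K' = max K 1"
  have 1: "cpoly K' + p \<in> M" "cpoly K' - p \<in> M"
    using quadratic_module_cpoly_mono[OF M assms(2), of K'] quadratic_module_cpoly_mono[OF M, of K "- p" K'] assms(3)
    by (auto simp: K'_def)
  have K': "K' > 0" by (simp add: K'_def)
  let ?q = "(cpoly K' - p)\<^sup>2 * (cpoly K' + p) + (cpoly K' + p)\<^sup>2 * (cpoly K' - p)"
  have "cpoly (1 / (2 * K')) * ?q \<in> M"
    using K' quadratic_module_add[OF M quadratic_module_square_mult[OF M 1(1)]
        quadratic_module_square_mult[OF M 1(2)]]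
    by (intro quadratic_module_cpoly_mult[OF M]) auto
  moreover have "cpoly (1 / (2 * K')) * ?q = cpoly (1 / (2 * K') * (2 * K')) * (cpoly (K'\<^sup>2) - p\<^sup>2)"
    by (simp only: cpoly_hom cpoly_numeral) (simp add: algebra_simps power2_eq_square)
  ultimately show ?thesis using K' by auto
qed

text \<open>The elements bounded on both sides by constants form a subalgebra. Products are handled
  by \<open>4 p q = (p + q)\<^sup>2 - (p - q)\<^sup>2\<close> and bounds on the two squares.\<close>

lemma archimedeanI:
  assumes M: "quadratic_module M"
    and var: "\<And>i. \<exists>K. cpoly K + xvar i \<in> M \<and> cpoly K - xvar i \<in> M"
  shows "archimedean M"
proof -
  have "\<exists>K. cpoly K + p \<in> M \<and> cpoly K - p \<in> M" for p
  proof (induction p rule: rpoly_induct)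
    case (const c)
    have "cpoly \<bar>c\<bar> + cpoly c \<in> M" "cpoly \<bar>c\<bar> - cpoly c \<in> M"
      using quadratic_module_cpoly[OF M, of "\<bar>c\<bar> + c"] quadratic_module_cpoly[OF M, of "\<bar>c\<bar> - c"]
      by (auto simp: cpoly_hom)
    then show ?case by blast
  next
    case (var i)
    show ?case by fact
  next
    case (add p q)
    then obtain K L where "cpoly K + p \<in> M" "cpoly K - p \<in> M" "cpoly L + q \<in> M" "cpoly L - q \<in> M"
      by blast
    then have "(cpoly K + p) + (cpoly L + q) \<in> M" "(cpoly K - p) + (cpoly L - q) \<in> M"
      using M by (auto intro: quadratic_module_add)
    then show ?case by (intro exI[of _ "K + L"]) (auto simp: cpoly_add algebra_simps)
  next
    case (mult p q)
    then obtain K L where KL: "cpoly K + p \<in> M" "cpoly K - p \<in> M" "cpoly L + q \<in> M" "cpoly L - q \<in> M"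
      by blast
    then have "(cpoly K + p) + (cpoly L + q) \<in> M" "(cpoly K - p) + (cpoly L - q) \<in> M"
      "(cpoly K + p) + (cpoly L - q) \<in> M" "(cpoly K - p) + (cpoly L + q) \<in> M"
      using M by (auto intro: quadratic_module_add)
    then have "\<exists>A. cpoly A - (p + q)\<^sup>2 \<in> M" "\<exists>B. cpoly B - (p - q)\<^sup>2 \<in> M"
      by (intro quadratic_module_bound_square[OF M, of "K + L"]; simp add: cpoly_add algebra_simps)+
    then obtain A B where AB: "cpoly A - (p + q)\<^sup>2 \<in> M" "cpoly B - (p - q)\<^sup>2 \<in> M" by blast
    have sq: "r\<^sup>2 \<in> M" for r using sos_subset_quadratic_module[OF M] by auto
    have "cpoly (1/4) * (cpoly A - (p + q)\<^sup>2 + (p - q)\<^sup>2) \<in> M"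
      "cpoly (1/4) * (cpoly B - (p - q)\<^sup>2 + (p + q)\<^sup>2) \<in> M"
      using AB sq by (auto intro!: quadratic_module_cpoly_mult[OF M] quadratic_module_add[OF M])
    moreover have "cpoly (1/4) * (cpoly A - (p + q)\<^sup>2 + (p - q)\<^sup>2) = cpoly (1/4 * A) - cpoly (1/4 * 4) * (p * q)"
      "cpoly (1/4) * (cpoly B - (p - q)\<^sup>2 + (p + q)\<^sup>2) = cpoly (1/4 * B) + cpoly (1/4 * 4) * (p * q)"
      by (simp_all only: cpoly_mult cpoly_numeral) (simp_all add: algebra_simps power2_eq_square)
    ultimately have "cpoly (A/4) - p * q \<in> M" "cpoly (B/4) + p * q \<in> M"
      by simp_all
    then show ?case
      using quadratic_module_cpoly_mono[OF M, of "A/4" "- (p * q)" "max (A/4) (B/4)"]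
        quadratic_module_cpoly_mono[OF M, of "B/4" "p * q" "max (A/4) (B/4)"]
      by (intro exI[of _ "max (A/4) (B/4)"]) auto
  qed
  then show ?thesis by (auto simp: archimedean_def)
qed

lemma archimedean_pos:
  assumes "quadratic_module M" "archimedean M"
  obtains K where "K > 0" "cpoly K - p \<in> M"
proof -
  obtain K where "cpoly K - p \<in> M" using assms(2) by (auto simp: archimedean_def)
  then have "cpoly (max K 1) - p \<in> M"
    using quadratic_module_cpoly_mono[OF assms(1), of K "- p" "max K 1"] by simp
  then show ?thesis using that[of "max K 1"] by auto
qed

section \<open>Infinitesimal elements\<close>

lemma infinitesimal_minus: "infinitesimal M p \<Longrightarrow> infinitesimal M (- p)"
  by (simp add: infinitesimal_def)

lemma infinitesimal_add:
  assumes M: "quadratic_module M" and "infinitesimal M p" "infinitesimal M q"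
  shows "infinitesimal M (p + q)"
  unfolding infinitesimal_def
proof (intro allI impI)
  fix e :: real assume "e > 0"
  then have "cpoly (e/2) + p \<in> M" "cpoly (e/2) - p \<in> M" "cpoly (e/2) + q \<in> M" "cpoly (e/2) - q \<in> M"
    using assms(2,3) by (auto simp: infinitesimal_def)
  from quadratic_module_add[OF M this(1,3)] quadratic_module_add[OF M this(2,4)]
  have "(cpoly (e/2) + p) + (cpoly (e/2) + q) \<in> M" "(cpoly (e/2) - p) + (cpoly (e/2) - q) \<in> M" .
  moreover have e: "cpoly e = cpoly (e/2) + cpoly (e/2)" by (simp flip: cpoly_add)
  ultimately show "cpoly e + (p + q) \<in> M \<and> cpoly e - (p + q) \<in> M"
    unfolding e by (simp add: algebra_simps)
qed

text \<open>If \<open>K\<close> bounds \<open>q\<^sup>2\<close>, then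
  \<open>e = (e / K) (K - q\<^sup>2) + q\<^sup>2 (e / K)\<close>; the last term absorbs
  \<open>q\<^sup>2 p\<close> because \<open>p\<close> is within \<open>e / K\<close> of 0.\<close>

lemma infinitesimal_square_mult:
  assumes M: "quadratic_module M" and arch: "archimedean M" and "infinitesimal M p"
  shows "infinitesimal M (q\<^sup>2 * p)"
  unfolding infinitesimal_def
proof (intro allI impI)
  fix e :: real assume e: "e > 0"
  obtain K where K: "K > 0" "cpoly K - q\<^sup>2 \<in> M" using archimedean_pos[OF M arch] by blast
  have 1: "cpoly (e/K) + p \<in> M" "cpoly (e/K) - p \<in> M"
    using assms(3) e K by (auto simp: infinitesimal_def)
  have "cpoly (e/K) * (cpoly K - q\<^sup>2) + q\<^sup>2 * (cpoly (e/K) + p) \<in> M"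
    "cpoly (e/K) * (cpoly K - q\<^sup>2) + q\<^sup>2 * (cpoly (e/K) - p) \<in> M"
    using e K 1 by (auto intro!: quadratic_module_add[OF M] quadratic_module_square_mult[OF M]
        quadratic_module_cpoly_mult[OF M])
  moreover have e: "cpoly e = cpoly (e/K) * cpoly K" using K by (simp flip: cpoly_mult)
  ultimately show "cpoly e + q\<^sup>2 * p \<in> M \<and> cpoly e - q\<^sup>2 * p \<in> M"
    unfolding e by (simp add: algebra_simps)
qed

text \<open>The squares are those of \<open>(p + 1) / 2\<close> and \<open>(p - 1) / 2\<close>. This
  reduces multiplication by an arbitrary polynomial to multiplication by squares.\<close>

lemma rpoly_square_diff:
  fixes p :: "'n::finite rpoly"
  obtains u v where "p = u\<^sup>2 - v\<^sup>2"
proof -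
  define h :: "'n rpoly" where "h = cpoly (1/2)"
  have h: "h * 2 = 1" unfolding h_def by (simp flip: cpoly_numeral cpoly_mult)
  have "(h * (p + 1))\<^sup>2 - (h * (p - 1))\<^sup>2 = (h * 2) * (h * 2) * p"
    by (simp add: algebra_simps power2_eq_square)
  then have "p = (h * (p + 1))\<^sup>2 - (h * (p - 1))\<^sup>2" by (simp add: h)
  then show ?thesis by (rule that)
qed

lemma infinitesimal_mult:
  assumes M: "quadratic_module M" and arch: "archimedean M" and p: "infinitesimal M p"
  shows "infinitesimal M (q * p)"
proof -
  obtain u v where "q = u\<^sup>2 - v\<^sup>2" by (rule rpoly_square_diff)
  then have "q * p = u\<^sup>2 * p + - (v\<^sup>2 * p)" by (simp add: left_diff_distrib)
  then show ?thesis
    using infinitesimal_add[OF M infinitesimal_square_mult[OF M arch p]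
        infinitesimal_minus[OF infinitesimal_square_mult[OF M arch p]]]
    by metis
qed

section \<open>Adjoining an element and maximal proper extensions\<close>

lemma quadratic_module_adjoin:
  assumes M: "quadratic_module M"
  shows "quadratic_module {m + s * p | m s. m \<in> M \<and> s \<in> sos}" (is "quadratic_module ?X")
    and "M \<subseteq> {m + s * p | m s. m \<in> M \<and> s \<in> sos}"
    and "p \<in> {m + s * p | m s. m \<in> M \<and> s \<in> sos}"
proof -
  show "quadratic_module ?X"
    unfolding quadratic_module_def
  proof (intro conjI ballI allI)
    show "1 \<in> ?X" using quadratic_module_one[OF M] by (force intro!: sos_0)
  next
    fix a b assume "a \<in> ?X" "b \<in> ?X"
    then obtain m s m' s' where ab: "a = m + s * p" "b = m' + s' * p"
      and "m \<in> M" "m' \<in> M" "s \<in> sos" "s' \<in> sos"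
      by blast
    moreover have "a + b = (m + m') + (s + s') * p" unfolding ab by (simp add: algebra_simps)
    ultimately show "a + b \<in> ?X" using quadratic_module_add[OF M] sos_add by blast
  next
    fix a q assume "a \<in> ?X"
    then obtain m s where a: "a = m + s * p" and "m \<in> M" "s \<in> sos" by blast
    moreover have "q\<^sup>2 * a = q\<^sup>2 * m + (q\<^sup>2 * s) * p" unfolding a by (simp add: algebra_simps)
    ultimately show "q\<^sup>2 * a \<in> ?X"
      using quadratic_module_square_mult[OF M] sos_mult_square by blast
  qed
  show "M \<subseteq> ?X" by (force intro!: sos_0)
  have "p = 0 + 1 * p" by simp
  then show "p \<in> ?X"
    using sos_subset_quadratic_module[OF M] sos_0 sos_1 by blast
qed

text \<open>Zorn's lemma gives a maximal \<open>N\<close> without \<open>-1\<close>. If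
  \<open>p\<close> and \<open>- p\<close> were both missing, then
  \<open>-1 = m + s p = m' - s' p\<close>. Eliminating \<open>p\<close> gives
  \<open>- s \<in> N\<close>, which forces \<open>s p \<in> N\<close> and then
  \<open>-1 \<in> N\<close>.\<close>

lemma quadratic_module_total_extension:
  assumes M: "quadratic_module M" and "-1 \<notin> M"
  obtains N where "quadratic_module N" "M \<subseteq> N" "-1 \<notin> N" "\<And>p. p \<in> N \<or> - p \<in> N"
proof -
  define \<A> where "\<A> = {N. quadratic_module N \<and> M \<subseteq> N \<and> -1 \<notin> N}"
  have "\<exists>N\<in>\<A>. \<forall>X\<in>\<A>. N \<subseteq> X \<longrightarrow> X = N"
  proof (rule subset_Zorn_nonempty)
    show "\<A> \<noteq> {}" using assms by (auto simp: \<A>_def)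
  next
    fix \<C> assume ne: "\<C> \<noteq> {}" and ch: "subset.chain \<A> \<C>"
    have sub: "\<C> \<subseteq> \<A>" using ch by (simp add: subset_chain_def)
    have "quadratic_module (\<Union>\<C>)"
      unfolding quadratic_module_def
    proof (intro conjI ballI allI)
      show "1 \<in> \<Union>\<C>" using ne sub by (auto simp: \<A>_def quadratic_module_def)
    next
      fix p q assume "p \<in> \<Union>\<C>" "q \<in> \<Union>\<C>"
      then obtain X Y where XY: "X \<in> \<C>" "Y \<in> \<C>" "p \<in> X" "q \<in> Y" by blast
      have "X \<subseteq> Y \<or> Y \<subseteq> X" using ch XY by (auto simp: subset_chain_def)
      then obtain Z where "Z \<in> \<C>" "p \<in> Z" "q \<in> Z" using XY by blast
      moreover from this have "quadratic_module Z" using sub by (auto simp: \<A>_def)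
      ultimately show "p + q \<in> \<Union>\<C>" using quadratic_module_add by blast
    next
      fix p q assume "p \<in> \<Union>\<C>"
      then obtain Z where "Z \<in> \<C>" "p \<in> Z" by blast
      moreover from this have "quadratic_module Z" using sub by (auto simp: \<A>_def)
      ultimately show "q\<^sup>2 * p \<in> \<Union>\<C>" using quadratic_module_square_mult by blast
    qed
    then show "\<Union>\<C> \<in> \<A>" using ne sub by (auto simp: \<A>_def)
  qed
  then obtain N where "N \<in> \<A>" and max: "\<And>X. X \<in> \<A> \<Longrightarrow> N \<subseteq> X \<Longrightarrow> X = N" by blast
  then have N: "quadratic_module N" "M \<subseteq> N" "-1 \<notin> N" by (auto simp: \<A>_def)
  \<comment> \<open>By maximality, adjoining any element outside \<open>N\<close> must produce
    \<open>-1\<close>.\<close>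
  have ext: "\<exists>m\<in>N. \<exists>s\<in>sos. -1 = m + s * p" if "p \<notin> N" for p
  proof (rule ccontr)
    assume contra: "\<not> ?thesis"
    let ?X = "{m + s * p | m s. m \<in> N \<and> s \<in> sos}"
    have "?X \<in> \<A>" using quadratic_module_adjoin[OF N(1), of p] contra N by (auto simp: \<A>_def)
    then have "?X = N" using max quadratic_module_adjoin(2)[OF N(1)] by blast
    then show False using that quadratic_module_adjoin(3)[OF N(1), of p] by simp
  qed
  have total: "p \<in> N \<or> - p \<in> N" for p
  proof (rule ccontr)
    assume "\<not> ?thesis"
    then obtain m s m' s' where ms: "m \<in> N" "s \<in> sos" "-1 = m + s * p"
      and ms': "m' \<in> N" "s' \<in> sos" "-1 = m' + s' * - p"
      using ext[of p] ext[of "- p"] by blast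
    have sp: "s * p = - 1 - m" unfolding ms(3) by simp
    have "s' * p = m' - (m' + s' * - p)" by simp
    then have sp': "s' * p = 1 + m'" unfolding ms'(3)[symmetric] by simp
    have sN: "t \<in> N" if "t \<in> sos" for t using that sos_subset_quadratic_module[OF N(1)] by blast
    have "s' * (- 1 - m) = s * (1 + m')" by (metis sp sp' mult.left_commute)
    moreover have "s' + s' * m + s * m' + s = s * (1 + m') - s' * (- 1 - m)"
      by (simp add: algebra_simps)
    ultimately have "s' + s' * m + s * m' + s = 0" by simp
    then have "- s = s' + s' * m + s * m'"
      by (metis add.commute minus_unique)
    then have ns: "- s \<in> N"
      using ms ms' sN by (auto intro!: quadratic_module_add[OF N(1)] quadratic_module_sos_mult[OF N(1)])
    \<comment> \<open>With both \<open>s\<close> and \<open>- s\<close> in \<open>N\<close>, every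
      polynomial multiple of \<open>s\<close> lies in \<open>N\<close>.\<close>
    obtain u v where uv: "p = u\<^sup>2 - v\<^sup>2" by (rule rpoly_square_diff)
    have "s * p = u\<^sup>2 * s + v\<^sup>2 * (- s)" unfolding uv by (simp add: algebra_simps)
    moreover have "u\<^sup>2 * s + v\<^sup>2 * (- s) \<in> N"
      by (intro quadratic_module_add[OF N(1)] quadratic_module_square_mult[OF N(1)] ns sN ms)
    ultimately have "s * p \<in> N" by simp
    then have "s * p + m \<in> N" using ms by (intro quadratic_module_add[OF N(1)])
    then show False using N(3) ms(3) by (simp add: add.commute)
  qed
  show ?thesis using that N total by blast
qed

text \<open>Each polynomial differs by an infinitesimal from one real constant, its value.
  Infinitesimals form an ideal, so taking values respects sums and products; it is evaluation at the
  point formed by the values of the variables.\<close>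

lemma total_quadratic_module_evaluation:
  assumes N: "quadratic_module N" and arch: "archimedean N" and "-1 \<notin> N"
    and total: "\<And>p. p \<in> N \<or> - p \<in> N"
  obtains y where "\<And>p. p \<in> N \<Longrightarrow> 0 \<le> peval p y"
proof -
  have neg: "cpoly c \<notin> N" if "c < 0" for c
  proof
    assume "cpoly c \<in> N"
    then have "cpoly (1 / - c) * cpoly c \<in> N" using that by (intro quadratic_module_cpoly_mult[OF N]) auto
    then show False using that assms(3) by (simp add: cpoly_minus flip: cpoly_mult)
  qed
  have "\<exists>c. infinitesimal N (p - cpoly c)" for p
  proof -
    \<comment> \<open>The lower cut of \<open>p\<close>: the constants below \<open>p\<close> in the
      order of \<open>N\<close>. Its supremum is the value of \<open>p\<close>.\<close>
    define C where "C = {c. p - cpoly c \<in> N}"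
    obtain K where K: "cpoly K - p \<in> N" using arch by (auto simp: archimedean_def)
    have "c \<le> K" if "c \<in> C" for c
    proof (rule ccontr)
      assume "\<not> ?thesis"
      moreover have "(cpoly K - p) + (p - cpoly c) \<in> N"
        using that K by (intro quadratic_module_add[OF N]) (auto simp: C_def)
      ultimately show False using neg[of "K - c"] by (simp add: cpoly_diff)
    qed
    then have bdd: "bdd_above C" by (meson bdd_aboveI)
    obtain L where "cpoly L - - p \<in> N" using arch unfolding archimedean_def by blast
    then have "- L \<in> C" by (simp add: C_def cpoly_minus add.commute)
    then have ne: "C \<noteq> {}" by blast
    have "infinitesimal N (p - cpoly (Sup C))"
      unfolding infinitesimal_def
    proof (intro allI impI conjI)
      fix e :: real assume e: "e > 0"
      obtain c where c: "c \<in> C" "Sup C - e < c" using less_cSup_iff[OF ne bdd, of "Sup C - e"] e by auto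
      then have "cpoly (- c) + p \<in> N" by (simp add: C_def cpoly_minus)
      from quadratic_module_cpoly_mono[OF N this, of "e - Sup C"] c
      show "cpoly e + (p - cpoly (Sup C)) \<in> N" by (simp add: cpoly_diff algebra_simps)
      \<comment> \<open>Totality enters here: a constant that is not below \<open>p\<close> must be
        above it.\<close>
      have "Sup C + e \<notin> C" using cSup_upper[OF _ bdd, of "Sup C + e"] e by auto
      then have "- (p - cpoly (Sup C + e)) \<in> N" using total[of "p - cpoly (Sup C + e)"] by (auto simp: C_def)
      then show "cpoly e - (p - cpoly (Sup C)) \<in> N" by (simp add: cpoly_add algebra_simps)
    qed
    then show ?thesis by blast
  qed
  then have "\<forall>i. \<exists>c. infinitesimal N (xvar i - cpoly c)" by blast
  from choice[OF this] obtain v where v: "\<And>i. infinitesimal N (xvar i - cpoly (v i))"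
    by blast
  define y where "y = (\<chi> i. v i)"
  have inf: "infinitesimal N (p - cpoly (peval p y))" for p
  proof (induction p rule: rpoly_induct)
    case (const c)
    show ?case using quadratic_module_cpoly[OF N] by (simp add: infinitesimal_def)
  next
    case (var i)
    show ?case using v[of i] by (simp add: y_def)
  next
    case (add p q)
    from infinitesimal_add[OF N this] show ?case by (simp add: peval_add cpoly_add algebra_simps)
  next
    case (mult p q)
    \<comment> \<open>Uses \<open>p q - p(y) q(y) = q (p - p(y)) + p(y) (q - q(y))\<close>.\<close>
    from infinitesimal_add[OF N infinitesimal_mult[OF N arch mult(1), of q]
        infinitesimal_mult[OF N arch mult(2), of "cpoly (peval p y)"]]
    show ?case by (simp add: peval_mult cpoly_mult algebra_simps)
  qed
  have "0 \<le> peval p y" if "p \<in> N" for p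
  proof (rule ccontr)
    assume p: "\<not> ?thesis"
    \<comment> \<open>Half of the negative value is used as tolerance, so that adding
      \<open>p\<close> leaves a constant that is still negative.\<close>
    then have "cpoly (- peval p y / 2) - (p - cpoly (peval p y)) \<in> N"
      using inf[of p] by (auto simp: infinitesimal_def)
    from quadratic_module_add[OF N this that]
    have "cpoly (peval p y / 2) \<in> N"
      by (simp flip: cpoly_add)
    then show False using neg p by auto
  qed
  then show ?thesis using that by blast
qed

text \<open>Putinar's theorem.  If \<open>p\<close> is not in \<open>M\<close>, then either \<open>M - p \<Sigma>\<close> is proper, and a point is
  read off a maximal proper extension of it, or \<open>p s - 1 \<in> M\<close> for a sum of squares \<open>s\<close>; in the latter
  case \<open>p + c \<in> M\<close> implies \<open>p + c - 1 / k\<^sup>2 \<in> M\<close> for a fixed \<open>k\<close>, hence \<open>p \<in> M\<close> after finitely many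
  steps.\<close>

theorem positive_in_archimedean_quadratic_module:
  assumes M: "quadratic_module M" and arch: "archimedean M"
    and pos: "\<And>y. (\<And>q. q \<in> M \<Longrightarrow> 0 \<le> peval q y) \<Longrightarrow> 0 < peval p y"
  shows "p \<in> M"
proof -
  define X where "X = {m + s * - p | m s. m \<in> M \<and> s \<in> sos}"
  note X = quadratic_module_adjoin[OF M, of "- p", folded X_def]
  have "-1 \<in> X"
  proof (rule ccontr)
    assume "-1 \<notin> X"
    then obtain N where N: "quadratic_module N" "X \<subseteq> N" "-1 \<notin> N" "\<And>p. p \<in> N \<or> - p \<in> N"
      using quadratic_module_total_extension[OF X(1)] by metis
    have "archimedean N" using arch X(2) N(2) unfolding archimedean_def by blast
    then obtain y where y: "\<And>q. q \<in> N \<Longrightarrow> 0 \<le> peval q y"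
      using total_quadratic_module_evaluation[OF N(1) _ N(3,4)] by metis
    have "0 < peval p y" using pos y X(2) N(2) by blast
    moreover have "0 \<le> peval (- p) y" using y N(2) X(3) by blast
    ultimately show False by (simp add: peval_minus)
  qed
  then obtain s where s: "s \<in> sos" "p * s - 1 \<in> M"
    unfolding X_def by (auto simp: algebra_simps)
  obtain K1 where K1: "K1 > 0" "cpoly K1 - s \<in> M" using archimedean_pos[OF M arch] by blast
  obtain K2 where K2: "K2 > 0" "cpoly K2 - s\<^sup>2 * p \<in> M" using archimedean_pos[OF M arch] by blast
  \<comment> \<open>One constant serving both bounds: \<open>2 k\<close> exceeds \<open>K1\<close>
    and \<open>2 k - 1\<close> exceeds \<open>K2\<close>.\<close>
  define k where "k = K1 + K2 + 1"
  have k: "k > 0" "cpoly (2 * k) - s \<in> M" "cpoly (2 * k - 1) - s\<^sup>2 * p \<in> M"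
    using K1 K2 quadratic_module_cpoly_mono[OF M, of K1 "- s" "2 * k"]
      quadratic_module_cpoly_mono[OF M, of K2 "- (s\<^sup>2 * p)" "2 * k - 1"]
    by (auto simp: k_def)
  have step: "cpoly (c - 1 / k\<^sup>2) + p \<in> M" if c: "c \<ge> 0" "cpoly c + p \<in> M" for c
  proof -
    \<comment> \<open>All four summands lie in \<open>M\<close>, and every term containing
      \<open>s\<close> cancels in their sum. Dividing by \<open>k\<^sup>2\<close> then gives the
      step.\<close>
    have "(cpoly k - s)\<^sup>2 * (cpoly c + p) + cpoly (2 * k) * (p * s - 1)
        + cpoly c * (s * (cpoly (2 * k) - s)) + (cpoly (2 * k - 1) - s\<^sup>2 * p) \<in> M" (is "?m \<in> M")
      using k(1) by (intro quadratic_module_add[OF M _ k(3)] quadratic_module_add[OF M]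
          quadratic_module_cpoly_mult[OF M _ s(2)] quadratic_module_cpoly_mult[OF M c(1)]
          quadratic_module_square_mult[OF M c(2)] quadratic_module_sos_mult[OF M s(1) k(2)]) auto
    also have "?m = cpoly (k\<^sup>2) * p + cpoly (k\<^sup>2) * cpoly c - 1"
      by (simp add: cpoly_hom algebra_simps power2_eq_square)
    finally have "cpoly (1 / k\<^sup>2) * (cpoly (k\<^sup>2) * p + cpoly (k\<^sup>2) * cpoly c - 1) \<in> M"
      by (intro quadratic_module_cpoly_mult[OF M]) auto
    also have "cpoly (1 / k\<^sup>2) * (cpoly (k\<^sup>2) * p + cpoly (k\<^sup>2) * cpoly c - 1)
      = cpoly (1 / k\<^sup>2 * k\<^sup>2) * p + cpoly (1 / k\<^sup>2 * k\<^sup>2 * c - 1 / k\<^sup>2)"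
      by (simp only: cpoly_mult cpoly_diff) (simp add: algebra_simps)
    finally show ?thesis using k(1) by (simp add: add.commute)
  qed
  obtain c0 where c0: "c0 > 0" "cpoly c0 - - p \<in> M" using archimedean_pos[OF M arch] by blast
  \<comment> \<open>\<open>step\<close> requires a nonnegative constant, so the decreasing sequence
    is cut off at 0.\<close>
  have iter: "cpoly (max 0 (c0 - real j / k\<^sup>2)) + p \<in> M" for j
  proof (induction j)
    case 0
    show ?case using c0 by simp
  next
    case (Suc j)
    from step[OF _ Suc] have "cpoly (max 0 (c0 - real j / k\<^sup>2) - 1 / k\<^sup>2) + p \<in> M" by simp
    moreover have "0 \<le> 1 / k\<^sup>2" by simp
    then have "max 0 (c0 - real j / k\<^sup>2) - 1 / k\<^sup>2 \<le> max 0 (c0 - real (Suc j) / k\<^sup>2)"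
      unfolding of_nat_Suc add_divide_distrib by linarith
    ultimately show ?case
      by (rule quadratic_module_cpoly_mono[OF M])
  qed
  obtain j :: nat where "c0 * k\<^sup>2 \<le> real j" using real_arch_simple by blast
  then have "c0 - real j / k\<^sup>2 \<le> 0" using k(1) by (simp add: field_simps)
  with iter[of j] show ?thesis by (simp add: max_def split: if_splits)
qed

subsection \<open>Domination of squares by the perturbation\<close>

lemma Theta_eq: "Theta r b = 1 + (\<Sum>i\<in>UNIV. ((cpoly (1 / b) * xvar i)\<^sup>2) ^ r)"
  by (simp add: Theta_def power_mult)

lemma peval_Theta: "peval (Theta r b) x = 1 + (\<Sum>i\<in>UNIV. (x $ i / b) ^ (2 * r))"
  by (simp add: Theta_def peval_hom)

lemma one_sos_le_Theta: "1 \<preceq> Theta r b"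
  by (auto simp: Theta_eq sos_le_def intro!: sos_sum sos_power[OF sos_square])

lemma Theta_sos [simp]: "Theta r b \<in> sos"
  by (auto simp: Theta_eq intro!: sos_add sos_sum sos_power[OF sos_square])

lemma power_sos_le_Theta: "((cpoly (1 / b) * xvar i)\<^sup>2) ^ r \<preceq> Theta r b"
proof -
  have "Theta r b - ((cpoly (1 / b) * xvar i)\<^sup>2) ^ r
      = 1 + (\<Sum>j\<in>UNIV - {i}. ((cpoly (1 / b) * xvar j)\<^sup>2) ^ r)"
    by (simp add: Theta_eq sum.remove[of UNIV i])
  then show ?thesis
    unfolding sos_le_def by (auto intro!: sos_add sos_sum sos_power[OF sos_square])
qed

text \<open>Every summand of \<open>Theta r b\<close> has the form \<open>t ^ r\<close>, with
  \<open>t\<close> equal to 1 or a scaled squared variable, and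
  \<open>t ^ Suc r \<preceq> Theta (Suc r) b\<close>. By \<open>power_mult_power_sos_le\<close> each
  of the \<open>n + 1\<close> products \<open>t ^ r * s\<close> costs at most two copies of
  \<open>Theta (Suc r) b\<close>.\<close>

lemma Theta_mult_sos_le:
  fixes s :: "'n::finite rpoly"
  assumes s: "s \<in> sos" and le: "s ^ Suc r \<preceq> Theta (Suc r) b"
  shows "s * Theta r b \<preceq> of_nat (2 * (CARD('n) + 1)) * Theta (Suc r) b"
proof -
  let ?T = "Theta (Suc r) b"
  let ?u = "\<lambda>i::'n. (cpoly (1 / b) * xvar i)\<^sup>2"
  have T: "t ^ r * s ^ 1 \<preceq> ?T + ?T" if "t \<in> sos" "t ^ Suc r \<preceq> ?T" for t
    using sos_le_trans[OF power_mult_power_sos_le[OF that(1) s, of r 1, folded Suc_eq_plus1]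
        sos_le_add[OF that(2) le]] .
  have "s * Theta r b = 1 ^ r * s ^ 1 + (\<Sum>i\<in>UNIV. ?u i ^ r * s ^ 1)"
    by (simp add: Theta_eq distrib_left sum_distrib_left mult.commute)
  also have "\<dots> \<preceq> (?T + ?T) + (\<Sum>i\<in>(UNIV::'n set). ?T + ?T)"
    by (intro sos_le_add sos_le_sum T power_sos_le_Theta) (auto simp: one_sos_le_Theta)
  also have "\<dots> = of_nat (2 * (CARD('n) + 1)) * ?T"
    by (simp add: algebra_simps)
  finally show ?thesis .
qed

text \<open>Iterates \<open>Theta_mult_sos_le\<close> with \<open>s = 1\<close>. The constant
  depends on the shift \<open>d\<close> only, not on \<open>r\<close>, so different shifts can be
  brought to a common one.\<close>

lemma Theta_sos_le_Theta_add:
  "Theta r b \<preceq> cpoly (real (2 * (CARD('n) + 1)) ^ d) * (Theta (r + d) b :: 'n::finite rpoly)"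
proof (induction d)
  case (Suc d)
  let ?K = "real (2 * (CARD('n) + 1))"
  have "1 * Theta (r + d) b \<preceq> of_nat (2 * (CARD('n) + 1)) * (Theta (Suc (r + d)) b :: 'n rpoly)"
    by (rule Theta_mult_sos_le) (auto simp: one_sos_le_Theta)
  then have "cpoly (?K ^ d) * Theta (r + d) b
      \<preceq> cpoly (?K ^ d) * (cpoly ?K * (Theta (Suc (r + d)) b :: 'n rpoly))"
    by (intro sos_le_cpoly_mult) (simp_all only: cpoly_of_nat mult_1, simp)
  also have "\<dots> = cpoly (?K ^ Suc d) * Theta (r + Suc d) b"
    by (simp only: cpoly_hom power_Suc mult.assoc mult.left_commute add_Suc_right)
  finally show ?case using Suc.IH by (rule sos_le_trans[rotated])
qed simp

text \<open>The point is that \<open>C\<close> and \<open>d\<close> are chosen before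
  \<open>r\<close>. Sums use \<open>(p + q)\<^sup>2 \<preceq> 2 p\<^sup>2 + 2 q\<^sup>2\<close> and
  the common shift \<open>d + e\<close>; products apply the two bounds in succession.\<close>

lemma square_mult_Theta_bounded:
  fixes p :: "'n::finite rpoly"
  assumes b: "b > 0"
  shows "\<exists>C>0. \<exists>d. \<forall>r. p\<^sup>2 * Theta r b \<preceq> cpoly C * Theta (r + d) b"
proof (induction p rule: rpoly_induct)
  case (const c)
  \<comment> \<open>The summand 1 keeps the constant strictly positive when \<open>c\<close> is
    0.\<close>
  have "(cpoly c)\<^sup>2 * Theta r b \<preceq> cpoly (c\<^sup>2 + 1) * Theta (r + 0) b" for r
    by (simp add: sos_le_def cpoly_add cpoly_power distrib_right)
  then show ?case
    by (metis add_nonneg_pos zero_le_power2 zero_less_one)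
next
  case (var i)
  let ?K = "real (2 * (CARD('n) + 1))" and ?u = "(cpoly (1 / b) * xvar i)\<^sup>2 :: 'n rpoly"
  have "(xvar i)\<^sup>2 * Theta r b \<preceq> cpoly (b\<^sup>2 * ?K) * Theta (r + 1) b" for r
  proof -
    have "xvar i = cpoly (b * (1 / b)) * xvar i" using b by simp
    then have "(xvar i)\<^sup>2 * Theta r b = (cpoly (b * (1 / b)) * xvar i)\<^sup>2 * Theta r b" by simp
    also have "\<dots> = cpoly (b\<^sup>2) * (?u * Theta r b)"
      by (simp only: cpoly_hom power_mult_distrib mult.assoc)
    also have "\<dots> \<preceq> cpoly (b\<^sup>2) * (of_nat (2 * (CARD('n) + 1)) * Theta (Suc r) b)"
      by (intro sos_le_cpoly_mult Theta_mult_sos_le power_sos_le_Theta) auto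
    also have "\<dots> = cpoly (b\<^sup>2 * ?K) * Theta (r + 1) b"
      by (simp only: cpoly_mult cpoly_of_nat mult.assoc Suc_eq_plus1)
    finally show ?thesis .
  qed
  moreover have "b\<^sup>2 * ?K > 0" using b by simp
  ultimately show ?case by blast
next
  case (add p q)
  let ?K = "real (2 * (CARD('n) + 1))"
  obtain C d D e where C: "C > 0" "\<And>r. p\<^sup>2 * Theta r b \<preceq> cpoly C * Theta (r + d) b"
    and D: "D > 0" "\<And>r. q\<^sup>2 * Theta r b \<preceq> cpoly D * Theta (r + e) b"
    using add by metis
  have "(p + q)\<^sup>2 * Theta r b
      \<preceq> cpoly (2 * C * ?K ^ e + 2 * D * ?K ^ d) * Theta (r + (d + e)) b" for r
  proof -
    have "(p - q)\<^sup>2 * Theta r b \<in> sos" by (intro sos_mult) auto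
    then have "(p + q)\<^sup>2 * Theta r b \<preceq> cpoly 2 * (p\<^sup>2 * Theta r b) + cpoly 2 * (q\<^sup>2 * Theta r b)"
      by (simp add: sos_le_def algebra_simps power2_eq_square)
    also have "\<dots> \<preceq> cpoly 2 * (cpoly C * Theta (r + d) b) + cpoly 2 * (cpoly D * Theta (r + e) b)"
      by (intro sos_le_add sos_le_cpoly_mult C D) auto
    also have "\<dots> \<preceq> cpoly 2 * (cpoly C * (cpoly (?K ^ e) * Theta (r + d + e) b))
        + cpoly 2 * (cpoly D * (cpoly (?K ^ d) * Theta (r + e + d) b))"
      using C(1) D(1) by (intro sos_le_add sos_le_cpoly_mult Theta_sos_le_Theta_add) auto
    also have "\<dots> = cpoly (2 * C * ?K ^ e + 2 * D * ?K ^ d) * Theta (r + (d + e)) b"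
      by (simp only: cpoly_add cpoly_mult distrib_right mult.assoc add.assoc add.commute[of e d])
    finally show ?thesis .
  qed
  moreover have "2 * C * ?K ^ e + 2 * D * ?K ^ d > 0"
    using C(1) D(1) by (intro add_pos_pos mult_pos_pos zero_less_power) auto
  ultimately show ?case by blast
next
  case (mult p q)
  obtain C d D e where C: "C > 0" "\<And>r. p\<^sup>2 * Theta r b \<preceq> cpoly C * Theta (r + d) b"
    and D: "D > 0" "\<And>r. q\<^sup>2 * Theta r b \<preceq> cpoly D * Theta (r + e) b"
    using mult by metis
  have "(p * q)\<^sup>2 * Theta r b \<preceq> cpoly (C * D) * Theta (r + (e + d)) b" for r
  proof -
    have "(p * q)\<^sup>2 * Theta r b = p\<^sup>2 * (q\<^sup>2 * Theta r b)" by (simp add: power_mult_distrib mult.assoc)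
    also have "\<dots> \<preceq> p\<^sup>2 * (cpoly D * Theta (r + e) b)"
      by (intro sos_le_mult D) simp
    also have "\<dots> = cpoly D * (p\<^sup>2 * Theta (r + e) b)" by (rule mult.left_commute)
    also have "\<dots> \<preceq> cpoly D * (cpoly C * Theta (r + e + d) b)"
      using D(1) by (intro sos_le_cpoly_mult C) auto
    also have "\<dots> = cpoly (C * D) * Theta (r + (e + d)) b"
      by (simp only: cpoly_mult mult.assoc mult.left_commute add.assoc)
    finally show ?thesis .
  qed
  moreover have "C * D > 0" using C(1) D(1) by simp
  ultimately show ?case by blast
qed

text \<open>All large \<open>r\<close> are demanded, rather than one, so that two members have an
  admissible \<open>r\<close> in common and can be added.\<close>

definition perturbed_sos :: "real \<Rightarrow> 'n::finite rpoly set" where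
  "perturbed_sos b = {p. \<forall>e>0. \<exists>r0. \<forall>r\<ge>r0. p + cpoly e * Theta r b \<in> sos}"

lemma sos_subset_perturbed_sos: "sos \<subseteq> perturbed_sos b"
  by (auto simp: perturbed_sos_def intro!: sos_add sos_mult sos_cpoly)

text \<open>Sums split the perturbation in half. For \<open>q\<^sup>2 * p\<close>, perturb
  \<open>p\<close> by \<open>(e / C) Theta (r - d) b\<close>; multiplied by
  \<open>q\<^sup>2\<close>, this is dominated by \<open>e Theta r b\<close>.\<close>

lemma quadratic_module_perturbed_sos:
  assumes b: "b > 0"
  shows "quadratic_module (perturbed_sos b :: 'n::finite rpoly set)"
  unfolding quadratic_module_def
proof (intro conjI ballI allI)
  show "(1 :: 'n rpoly) \<in> perturbed_sos b" using sos_1 sos_subset_perturbed_sos by blast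
next
  fix p q :: "'n rpoly" assume pq: "p \<in> perturbed_sos b" "q \<in> perturbed_sos b"
  show "p + q \<in> perturbed_sos b"
    unfolding perturbed_sos_def
  proof (intro CollectI allI impI)
    fix e :: real assume "e > 0"
    then have "e / 2 > 0" by simp
    with pq obtain r1 r2 where r: "\<And>r. r \<ge> r1 \<Longrightarrow> p + cpoly (e/2) * Theta r b \<in> sos"
      "\<And>r. r \<ge> r2 \<Longrightarrow> q + cpoly (e/2) * Theta r b \<in> sos"
      unfolding perturbed_sos_def by blast
    have e: "cpoly e = cpoly (e/2) + cpoly (e/2)" by (simp flip: cpoly_add)
    have "p + q + cpoly e * Theta r b \<in> sos" if "r \<ge> max r1 r2" for r
      using sos_add[OF r(1)[of r] r(2)[of r]] that unfolding e by (simp add: algebra_simps)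
    then show "\<exists>r0. \<forall>r\<ge>r0. p + q + cpoly e * Theta r b \<in> sos" by blast
  qed
next
  fix p q :: "'n rpoly" assume p: "p \<in> perturbed_sos b"
  obtain C d where C: "C > 0" "\<And>r. q\<^sup>2 * Theta r b \<preceq> cpoly C * Theta (r + d) b"
    using square_mult_Theta_bounded[OF b, of q] by blast
  show "q\<^sup>2 * p \<in> perturbed_sos b"
    unfolding perturbed_sos_def
  proof (intro CollectI allI impI)
    fix e :: real assume e: "e > 0"
    then have "e / C > 0" using C by simp
    then obtain r0 where r0: "\<And>r. r \<ge> r0 \<Longrightarrow> p + cpoly (e / C) * Theta r b \<in> sos"
      using p by (auto simp: perturbed_sos_def)
    \<comment> \<open>With \<open>r \<ge> r0 + d\<close> the natural number subtraction
      \<open>r - d\<close> does not truncate, and \<open>r - d \<ge> r0\<close>.\<close>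
    have "q\<^sup>2 * p + cpoly e * Theta r b \<in> sos" if "r \<ge> r0 + d" for r
    proof -
      have "q\<^sup>2 * p + q\<^sup>2 * (cpoly (e / C) * Theta (r - d) b) \<in> sos"
        using sos_mult_square[OF r0[of "r - d"], of q] that by (simp add: distrib_left)
      moreover have "cpoly (e / C) * (q\<^sup>2 * Theta (r - d) b)
          \<preceq> cpoly (e / C) * (cpoly C * Theta (r - d + d) b)"
        using C e by (intro sos_le_cpoly_mult) auto
      then have "cpoly (e / C * C) * Theta r b - q\<^sup>2 * (cpoly (e / C) * Theta (r - d) b) \<in> sos"
        using that unfolding sos_le_def cpoly_mult by (simp add: mult.assoc mult.left_commute)
      ultimately have "(q\<^sup>2 * p + q\<^sup>2 * (cpoly (e / C) * Theta (r - d) b))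
          + (cpoly (e / C * C) * Theta r b - q\<^sup>2 * (cpoly (e / C) * Theta (r - d) b)) \<in> sos"
        by (rule sos_add)
      then show ?thesis using C(1) by simp
    qed
    then show "\<exists>r0. \<forall>r\<ge>r0. q\<^sup>2 * p + cpoly e * Theta r b \<in> sos" by blast
  qed
qed

text \<open>The correction in \<open>one_minus_plus_power_sos\<close> is \<open>1 / (r - 1)\<close>
  times a power dominated by \<open>Theta r b\<close>, and its coefficient drops below
  \<open>e\<close> for large \<open>r\<close>.\<close>

lemma one_minus_square_in_perturbed_sos:
  "1 - (cpoly (1 / b) * xvar i)\<^sup>2 \<in> perturbed_sos b"
  unfolding perturbed_sos_def
proof (intro CollectI allI impI)
  fix e :: real assume e: "e > 0"
  let ?u = "(cpoly (1 / b) * xvar i)\<^sup>2"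
  obtain N :: nat where N: "1 / e < real N" using reals_Archimedean2 by blast
  have "1 - ?u + cpoly e * Theta r b \<in> sos" if r: "r \<ge> N + 2" for r
  proof -
    let ?c = "1 / (real r - 1)"
    have "1 / e < real r - 1" using N r by linarith
    then have "?c \<le> e" using e r by (simp add: field_simps)
    then have 1: "cpoly (e - ?c) * Theta r b \<in> sos" by (intro sos_mult sos_cpoly) auto
    have "?c \<ge> 0" using r by simp
    from sos_le_cpoly_mult[OF this power_sos_le_Theta[of b i r]]
    have 2: "cpoly ?c * Theta r b - cpoly ?c * ?u ^ r \<in> sos" by (simp add: sos_le_def)
    have 3: "1 - ?u + cpoly ?c * ?u ^ r \<in> sos"
      using r by (intro one_minus_plus_power_sos) auto
    have eq: "1 - ?u + cpoly e * Theta r b = (1 - ?u + cpoly ?c * ?u ^ r)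
        + (cpoly ?c * Theta r b - cpoly ?c * ?u ^ r) + cpoly (e - ?c) * Theta r b"
      by (simp add: cpoly_diff left_diff_distrib)
    show ?thesis unfolding eq by (intro sos_add 1 2 3)
  qed
  then show "\<exists>r0. \<forall>r\<ge>r0. 1 - ?u + cpoly e * Theta r b \<in> sos" by blast
qed

text \<open>It suffices to bound the variables. With \<open>u\<close> the scaled variable and
  \<open>v = u\<close> or \<open>v = - u\<close>, the identity
  \<open>2 (1 + v) = (1 - v\<^sup>2) + (1 + v)\<^sup>2\<close> turns the bound on the square into a
  two-sided bound.\<close>

lemma archimedean_perturbed_sos:
  assumes b: "b > 0"
  shows "archimedean (perturbed_sos b :: 'n::finite rpoly set)"
proof (rule archimedeanI[OF quadratic_module_perturbed_sos[OF b]])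
  fix i :: 'n
  note M = quadratic_module_perturbed_sos[OF b]
  define u where "u = cpoly (1 / b) * xvar i"
  have u: "cpoly b * u = xvar i"
    using b by (simp add: u_def flip: mult.assoc cpoly_mult)
  have "(1 - v\<^sup>2) + (1 + v)\<^sup>2 \<in> perturbed_sos b" if "v\<^sup>2 = u\<^sup>2" for v
    unfolding that using one_minus_square_in_perturbed_sos[of b i] sos_subset_perturbed_sos[of b]
    by (intro quadratic_module_add[OF M]) (auto simp: u_def)
  then have *: "cpoly (b / 2) * ((1 - v\<^sup>2) + (1 + v)\<^sup>2) \<in> perturbed_sos b" if "v\<^sup>2 = u\<^sup>2" for v
    using b that by (intro quadratic_module_cpoly_mult[OF M]) auto
  have eq: "cpoly (b / 2) * ((1 - v\<^sup>2) + (1 + v)\<^sup>2) = cpoly (b / 2 * 2) * (1 + v)" for v :: "'n rpoly"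
    by (simp only: cpoly_mult cpoly_numeral) (simp add: algebra_simps power2_eq_square)
  have "cpoly b + xvar i \<in> perturbed_sos b" "cpoly b - xvar i \<in> perturbed_sos b"
    using *[of u] *[of "- u"] unfolding eq by (simp_all add: right_diff_distrib distrib_left u)
  then show "\<exists>K. cpoly K + xvar i \<in> perturbed_sos b \<and> cpoly K - xvar i \<in> perturbed_sos b" by blast
qed

text \<open>The members \<open>1 - (x_i / b)\<^sup>2\<close> confine to the box every point at which
  the whole module is nonnegative, so Putinar's theorem needs positivity only there.\<close>

theorem positive_on_box_perturbed_sos:
  fixes p :: "'n::finite rpoly"
  assumes b: "b > 0" and pos: "\<And>x. (\<And>i. \<bar>x $ i\<bar> \<le> b) \<Longrightarrow> 0 < peval p x"
  shows "p \<in> perturbed_sos b"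
proof (rule positive_in_archimedean_quadratic_module
    [OF quadratic_module_perturbed_sos[OF b] archimedean_perturbed_sos[OF b]])
  fix y :: "real ^ 'n" assume y: "\<And>q. q \<in> perturbed_sos b \<Longrightarrow> 0 \<le> peval q y"
  have "\<bar>y $ i\<bar> \<le> b" for i
  proof -
    have "(y $ i / b)\<^sup>2 \<le> 1"
      using y[OF one_minus_square_in_perturbed_sos[of b i]] by (simp add: peval_hom power2_eq_square)
    then have "\<bar>y $ i / b\<bar> \<le> 1" by (simp add: abs_square_le_1)
    then show ?thesis using b by simp
  qed
  then show "0 < peval p y" by (rule pos)
qed

subsection \<open>Supports and degrees\<close>

text \<open>Gives the multipliers of the relaxation, squares of \<open>k\<close>-th powers, the
  prescribed sparse support.\<close>

lemma supp_power_subset_minkowski_multiple: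
  assumes "supp p \<subseteq> F"
  shows "supp (p ^ k) \<subseteq> minkowski_multiple k F"
proof (induction k)
  case 0
  \<comment> \<open>The empty sum makes the 0-fold multiple equal to \<open>{0}\<close>, the support
    of 1.\<close>
  show ?case by (auto simp: minkowski_multiple_def)
next
  case (Suc k)
  show ?case
  proof
    fix c assume "c \<in> supp (p ^ Suc k)"
    then obtain a b where c: "c = a + b" "a \<in> F" "b \<in> minkowski_multiple k F"
      using keys_mult[of p "p ^ k"] assms Suc.IH unfolding power_Suc by blast
    then obtain g where g: "b = (\<Sum>i<k. g i)" "\<forall>i<k. g i \<in> F"
      by (auto simp: minkowski_multiple_def)
    have "c = (\<Sum>i<Suc k. (g(k := a)) i)" using c g by (simp add: add.commute)
    moreover have "\<forall>i<Suc k. (g(k := a)) i \<in> F" using c g by (auto simp: less_Suc_eq)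
    ultimately show "c \<in> minkowski_multiple (Suc k) F" unfolding minkowski_multiple_def by blast
  qed
qed

lemma total_deg_le_iff: "total_deg p \<le> d \<longleftrightarrow> (\<forall>a\<in>supp p. expo_deg a \<le> d)"
  by (simp add: total_deg_def)

lemma total_deg_add_le: "total_deg p \<le> d \<Longrightarrow> total_deg q \<le> d \<Longrightarrow> total_deg (p + q) \<le> d"
  unfolding total_deg_le_iff using keys_add[of p q] by blast

lemma total_deg_mult_le:
  assumes "total_deg p \<le> d" "total_deg q \<le> e"
  shows "total_deg (p * q) \<le> d + e"
proof -
  have "expo_deg (a + b) = expo_deg a + expo_deg b" for a b :: "'a expo"
    by (simp add: expo_deg_def lookup_add sum.distrib)
  then show ?thesis
    using assms keys_mult[of p q] unfolding total_deg_le_iff by (force intro: add_mono)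
qed

lemma total_deg_cpoly [simp]: "total_deg (cpoly c) = 0"
  by (simp add: total_deg_def cpoly_def expo_deg_def)

lemma total_deg_1 [simp]: "total_deg 1 = 0"
  using total_deg_cpoly[of 1] by simp

lemma total_deg_power_le: "total_deg p \<le> d \<Longrightarrow> total_deg (p ^ k) \<le> k * d"
proof (induction k)
  case 0
  show ?case by simp
next
  case (Suc k)
  then show ?case using total_deg_mult_le[of p d "p ^ k" "k * d"] by simp
qed

lemma total_deg_sum_le:
  "(\<And>i. i \<in> I \<Longrightarrow> total_deg (p i) \<le> d) \<Longrightarrow> total_deg (\<Sum>i\<in>I. p i) \<le> d"
  by (induction I rule: infinite_finite_induct)
    (auto simp: total_deg_le_iff[of 0] intro: total_deg_add_le)

lemma total_deg_cpoly_mult_le: "total_deg p \<le> d \<Longrightarrow> total_deg (cpoly c * p) \<le> d"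
  using total_deg_mult_le[of "cpoly c" 0 p d] by simp

lemma total_deg_Theta_le: "total_deg (Theta r b :: 'n::finite rpoly) \<le> 2 * r"
proof -
  have "total_deg (xvar i :: 'n rpoly) \<le> 1" for i
    by (simp add: total_deg_le_iff xvar_def expo_deg_def lookup_single when_def)
  then have "total_deg ((cpoly (1 / b) * xvar i :: 'n rpoly) ^ (2 * r)) \<le> 2 * r" for i
    using total_deg_power_le[OF total_deg_cpoly_mult_le, of "xvar i" 1 "1 / b" "2 * r"] by simp
  then show ?thesis unfolding Theta_def by (intro total_deg_add_le total_deg_sum_le) simp
qed

subsection \<open>The penalty\<close>

text \<open>Up to an error of order \<open>1 / n\<close>, the multiplier term dominates a linear
  penalty of any slope \<open>M\<close>. For \<open>t \<ge> 0\<close> the term is of size at most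
  \<open>R / n\<close>; for \<open>t < 0\<close> it grows at least like
  \<open>n t\<^sup>2 / R\<close>, which beats a linear function.\<close>

lemma penalty_lower_bound:
  fixes t R M :: real
  assumes R: "\<bar>t\<bar> \<le> R" "0 < R" and n: "0 < n"
  shows "M * max 0 (- t) - R * (M\<^sup>2 / 4 + 1) / real n \<le> - (t * (1 - t / R) ^ n)"
proof (cases "t \<ge> 0")
  case True
  define u where "u = t / R"
  have u: "0 \<le> u" "u \<le> 1" "t = R * u" using True R by (auto simp: u_def)
  \<comment> \<open>Bernoulli's inequality together with \<open>(1 - u) (1 + u) \<le> 1\<close>
    yields \<open>u (1 - u) ^ n \<le> 1 / n\<close>.\<close>
  have "(1 - u) ^ n * (1 + real n * u) \<le> (1 - u) ^ n * (1 + u) ^ n"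
    using u Bernoulli_inequality[of u n] by (intro mult_left_mono) auto
  also have "\<dots> = (1 - u\<^sup>2) ^ n" by (simp add: power2_eq_square algebra_simps flip: power_mult_distrib)
  also have "\<dots> \<le> 1" using u by (intro power_le_one) (auto simp: power_le_one)
  finally have "(1 - u) ^ n + real n * (u * (1 - u) ^ n) \<le> 1" by (simp add: algebra_simps)
  moreover have "0 \<le> (1 - u) ^ n" using u by simp
  ultimately have "real n * (u * (1 - u) ^ n) \<le> 1" by linarith
  then have "u * (1 - u) ^ n \<le> 1 / real n" using n by (simp add: field_simps)
  also have "\<dots> \<le> (M\<^sup>2 / 4 + 1) / real n" by (intro divide_right_mono) auto
  finally have "R * (u * (1 - u) ^ n) \<le> R * ((M\<^sup>2 / 4 + 1) / real n)"
    using R by (intro mult_left_mono) auto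
  then show ?thesis using True R by (simp add: u_def)
next
  case False
  define u where "u = - t / R"
  have u: "0 \<le> u" "t = - (R * u)" using False R by (auto simp: u_def field_simps)
  \<comment> \<open>Completing the square gives
    \<open>M u \<le> n u\<^sup>2 + M\<^sup>2 / (4 n)\<close>, the source of
    \<open>M\<^sup>2 / 4\<close> in the error.\<close>
  have "0 \<le> (2 * real n * u - M)\<^sup>2 / (4 * real n)" by simp
  also have "\<dots> = real n * u\<^sup>2 - M * u + M\<^sup>2 / 4 / real n"
    using n by (simp add: power2_eq_square field_simps)
  finally have "M * u - (M\<^sup>2 / 4 + 1) / real n \<le> u * (real n * u)"
    using n by (simp add: power2_eq_square add_divide_distrib algebra_simps)
      (smt (verit) divide_nonneg_nonneg of_nat_0_le_iff)
  also have "\<dots> \<le> u * (1 + u) ^ n"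
    using Bernoulli_inequality[of u n] u by (intro mult_left_mono) auto
  finally have "R * (M * u - (M\<^sup>2 / 4 + 1) / real n) \<le> R * (u * (1 + u) ^ n)"
    using R by (intro mult_left_mono) auto
  moreover have "max 0 (- t) = R * u" "1 - t / R = 1 + u" using u R by auto
  ultimately show ?thesis by (simp only:) (simp add: u(2) algebra_simps)
qed

text \<open>First an exact penalty: by compactness some slope \<open>M\<close> makes
  \<open>f + M h > - e / 2\<close>, where \<open>h\<close> is the total constraint violation. Then
  \<open>penalty_lower_bound\<close> replaces \<open>M h\<close> by the multiplier terms, with error
  below \<open>e / 2\<close>.\<close>

lemma penalized_positive_on_compact:
  fixes f :: "'a::topological_space \<Rightarrow> real" and g :: "'b \<Rightarrow> 'a \<Rightarrow> real"
  assumes B: "compact B" and J: "finite J"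
    and f: "continuous_on B f" and g: "\<And>j. j \<in> J \<Longrightarrow> continuous_on B (g j)"
    and nonneg: "\<And>x. x \<in> B \<Longrightarrow> (\<And>j. j \<in> J \<Longrightarrow> 0 \<le> g j x) \<Longrightarrow> 0 \<le> f x"
    and e: "0 < e"
  shows "\<exists>R>0. \<exists>k\<ge>1. \<forall>x\<in>B. 0 < f x + e - (\<Sum>j\<in>J. g j x * (1 - g j x / R) ^ (2 * k))"
proof (cases "B = {}")
  case True
  then show ?thesis by (auto intro!: exI[of _ 1])
next
  case False
  define h where "h = (\<lambda>x. \<Sum>j\<in>J. max 0 (- g j x))"
  have h_nonneg: "0 \<le> h x" for x unfolding h_def by (intro sum_nonneg) auto
  have "continuous_on B h" unfolding h_def by (intro continuous_intros g)
  then have "continuous_on B (\<lambda>x. max (f x + e / 2) (h x))" by (intro continuous_intros f)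
  from continuous_attains_inf[OF B False this] obtain x0 where x0: "x0 \<in> B"
    "\<And>x. x \<in> B \<Longrightarrow> max (f x0 + e / 2) (h x0) \<le> max (f x + e / 2) (h x)" by blast
  \<comment> \<open>Positive because \<open>h x0 = 0\<close> makes \<open>x0\<close> feasible,
    whence \<open>f x0 \<ge> 0\<close>.\<close>
  define \<delta> where "\<delta> = max (f x0 + e / 2) (h x0)"
  have \<delta>: "\<delta> > 0"
  proof (cases "h x0 > 0")
    case False
    then have "h x0 = 0" using h_nonneg[of x0] by simp
    then have "\<forall>j\<in>J. max 0 (- g j x0) = 0"
      unfolding h_def using J by (subst (asm) sum_nonneg_eq_0_iff) auto
    then have "0 \<le> f x0" by (intro nonneg x0) (auto simp: max_def split: if_splits)
    then show ?thesis using e by (simp add: \<delta>_def)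
  qed (simp add: \<delta>_def)
  obtain x1 where x1: "\<And>x. x \<in> B \<Longrightarrow> f x1 \<le> f x" using continuous_attains_inf[OF B False f] by blast
  \<comment> \<open>Where \<open>h \<ge> \<delta>\<close>, the penalty outweighs the minimum
    \<open>f x1\<close>; elsewhere \<open>f + e / 2\<close> is positive already.\<close>
  define M where "M = \<bar>f x1\<bar> / \<delta>"
  have M: "- e / 2 < f x + M * h x" if "x \<in> B" for x
  proof (cases "\<delta> \<le> h x")
    case True
    then have "M * \<delta> \<le> M * h x" using \<delta> by (intro mult_left_mono) (auto simp: M_def)
    moreover have "M * \<delta> = \<bar>f x1\<bar>" using \<delta> by (simp add: M_def)
    ultimately show ?thesis using x1[OF that] e by linarith
  next
    case False
    then have "0 < f x + e / 2" using x0(2)[OF that] \<delta> by (auto simp: \<delta>_def)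
    moreover have "0 \<le> M * h x" using \<delta> h_nonneg by (simp add: M_def)
    ultimately show ?thesis by linarith
  qed
  have "continuous_on B (\<lambda>x. \<Sum>j\<in>J. \<bar>g j x\<bar>)" by (intro continuous_intros g)
  from continuous_attains_sup[OF B False this] obtain x2 where x2: "x2 \<in> B"
    "\<And>x. x \<in> B \<Longrightarrow> (\<Sum>j\<in>J. \<bar>g j x\<bar>) \<le> (\<Sum>j\<in>J. \<bar>g j x2\<bar>)" by blast
  \<comment> \<open>The sum bounds every single \<open>\<bar>g j x\<bar>\<close> on
    \<open>B\<close>; the added 1 keeps \<open>R\<close> positive even if it vanishes.\<close>
  define R where "R = (\<Sum>j\<in>J. \<bar>g j x2\<bar>) + 1"
  have "0 \<le> (\<Sum>j\<in>J. \<bar>g j x2\<bar>)" by (intro sum_nonneg) auto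
  then have R: "R > 0" unfolding R_def by linarith
  have gR: "\<bar>g j x\<bar> \<le> R" if "x \<in> B" "j \<in> J" for j x
    using x2(2)[OF that(1)] member_le_sum[of j J "\<lambda>j. \<bar>g j x\<bar>"] that J by (simp add: R_def)
  define E where "E = R * (M\<^sup>2 / 4 + 1)"
  obtain k0 :: nat where k0: "real (card J) * E / e < real k0" using reals_Archimedean2 by blast
  define k where "k = Suc k0"
  have k: "k \<ge> 1" by (simp add: k_def)
  have "real (card J) * E / e < real k" using k0 by (simp add: k_def)
  then have small: "real (card J) * E / real (2 * k) < e / 2"
    using e k by (simp add: field_simps)
  have "0 < f x + e - (\<Sum>j\<in>J. g j x * (1 - g j x / R) ^ (2 * k))" if x: "x \<in> B" for x
  proof -
    have "M * h x - real (card J) * E / real (2 * k) = (\<Sum>j\<in>J. M * max 0 (- g j x) - E / real (2 * k))"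
      by (simp add: h_def sum_subtractf sum_distrib_left)
    also have "\<dots> \<le> (\<Sum>j\<in>J. - (g j x * (1 - g j x / R) ^ (2 * k)))"
      unfolding E_def using gR[OF x] R k by (intro sum_mono penalty_lower_bound) auto
    finally show ?thesis using M[OF x] small by (simp add: sum_negf)
  qed
  then show ?thesis using R k by blast
qed

subsection \<open>The bounds on the relaxation\<close>

theorem theorem2:
  fixes f :: "'n::finite rpoly" and m :: nat and fs :: "nat \<Rightarrow> 'n rpoly"
    and xstar :: "real ^ 'n" and fstar b \<epsilon> :: real
  assumes "optimal_solution f (feasible_set m fs) xstar"
    and "fstar = peval f xstar"
    and "b = max 1 (Max (range (\<lambda>i. \<bar>xstar $ i\<bar>)))"
    and "\<epsilon> > 0"
  shows "\<exists>rt r :: nat. 1 \<le> rt \<and> rt \<le> r \<and>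
    ereal (fstar - \<epsilon>) \<le> rho_hat f m fs b \<epsilon> rt r \<and>
    rho_hat f m fs b \<epsilon> rt r \<le> ereal (fstar + \<epsilon> * (real CARD('n) + 1))"
proof -
  have b: "b > 0" using assms(3) by simp
  have xb: "\<bar>xstar $ i\<bar> \<le> b" for i
    unfolding assms(3) by (intro max.coboundedI2 Max_ge) auto
  have feas: "0 \<le> peval (fs j) xstar" if "j \<in> {1..m}" for j
    using assms(1) that by (simp add: optimal_solution_def feasible_set_def)
  define B where "B = {x :: real ^ 'n. \<forall>i. \<bar>x $ i\<bar> \<le> b}"
  have "B = cbox (\<chi> i. - b) (\<chi> i. b)" by (auto simp: B_def mem_box_cart abs_le_iff minus_le_iff)
  then have "compact B" by simp
  have "0 \<le> peval f x - fstar" if "\<And>j. j \<in> {1..m} \<Longrightarrow> 0 \<le> peval (fs j) x" for x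
    using assms(1,2) that by (simp add: optimal_solution_def feasible_set_def)
  then have "\<exists>R>0. \<exists>k\<ge>1. \<forall>x\<in>B. 0 < (peval f x - fstar) + \<epsilon>
      - (\<Sum>j\<in>{1..m}. peval (fs j) x * (1 - peval (fs j) x / R) ^ (2 * k))"
    using \<open>compact B\<close> \<open>\<epsilon> > 0\<close>
    by (intro penalized_positive_on_compact continuous_intros continuous_on_peval) auto
  then obtain R k where R: "R > 0" and k: "k \<ge> 1" and pos: "\<And>x. x \<in> B \<Longrightarrow>
      0 < (peval f x - fstar) + \<epsilon>
        - (\<Sum>j\<in>{1..m}. peval (fs j) x * (1 - peval (fs j) x / R) ^ (2 * k))"
    by blast
  \<comment> \<open>Written as one square whose root is a \<open>k\<close>-th power, so that
    \<open>k\<close> can serve as \<open>rt\<close>.\<close>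
  define \<sigma> where "\<sigma> j = ((1 - cpoly (1 / R) * fs j) ^ k)\<^sup>2" for j
  define p where "p = f - cpoly (fstar - \<epsilon>) - (\<Sum>j=1..m. fs j * \<sigma> j)"
  have "p \<in> perturbed_sos b"
  proof (rule positive_on_box_perturbed_sos[OF b])
    fix x :: "real ^ 'n" assume "\<And>i. \<bar>x $ i\<bar> \<le> b"
    then have "x \<in> B" by (simp add: B_def)
    from pos[OF this] show "0 < peval p x"
      by (simp add: p_def \<sigma>_def peval_hom power_mult mult.commute[of 2] algebra_simps)
  qed
  then obtain r0 where r0: "\<And>r. r \<ge> r0 \<Longrightarrow> p + cpoly \<epsilon> * Theta r b \<in> sos"
    using assms(4) by (auto simp: perturbed_sos_def)
  \<comment> \<open>The three terms secure the sum of squares, \<open>rt \<le> r\<close>, and the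
    degree bound for \<open>p\<close>.\<close>
  define r where "r = max r0 (max k (total_deg p))"
  have "total_deg (p + cpoly \<epsilon> * Theta r b) \<le> 2 * r"
    by (intro total_deg_add_le total_deg_cpoly_mult_le total_deg_Theta_le) (simp add: r_def)
  then have deg: "p + cpoly \<epsilon> * Theta r b \<in> sos_deg r"
    using r0[of r] by (simp add: sos_deg_def r_def)
  have \<sigma>: "\<sigma> j \<in> sos_supp (minkowski_multiple k (supp (fs j) \<union> {0}))" for j
  proof -
    \<comment> \<open>The constant 1 is what requires the exponent 0 to be adjoined to the
      support.\<close>
    have "supp (1 - cpoly (1 / R) * fs j) \<subseteq> supp (fs j) \<union> {0}"
      using keys_diff[of 1 "cpoly (1 / R) * fs j"] keys_mult[of "cpoly (1 / R)" "fs j"]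
      by (auto simp: cpoly_def split: if_splits)
    from supp_power_subset_minkowski_multiple[OF this, of k] show ?thesis
      unfolding sos_supp_def \<sigma>_def
      by (intro CollectI exI[of _ 1] exI[of _ "\<lambda>_. (1 - cpoly (1 / R) * fs j) ^ k"]) simp
  qed
  \<comment> \<open>The value \<open>fstar - \<epsilon>\<close> is itself feasible, with
    \<open>p + cpoly \<epsilon> * Theta r b\<close> as \<open>\<sigma>\<^sub>0\<close>.\<close>
  have lower: "ereal (fstar - \<epsilon>) \<le> rho_hat f m fs b \<epsilon> k r"
    unfolding rho_hat_def
    by (rule Sup_upper, intro CollectI exI conjI, rule refl, rule deg)
      (use \<sigma> in \<open>auto simp: p_def algebra_simps\<close>)
  have upper: "rho_hat f m fs b \<epsilon> k r \<le> ereal (fstar + \<epsilon> * (real CARD('n) + 1))"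
    unfolding rho_hat_def
  proof (rule Sup_least, elim CollectE exE conjE)
    fix x \<rho> \<sigma>\<^sub>0 \<tau>
    assume x: "x = ereal \<rho>" and "\<sigma>\<^sub>0 \<in> sos_deg r"
      and \<tau>: "\<forall>j\<in>{1..m}. \<tau> j \<in> sos_supp (minkowski_multiple k (supp (fs j) \<union> {0}))"
      and "f - cpoly \<rho> + cpoly \<epsilon> * Theta r b - (\<Sum>j=1..m. fs j * \<tau> j) = \<sigma>\<^sub>0"
    then have "0 \<le> peval (f - cpoly \<rho> + cpoly \<epsilon> * Theta r b - (\<Sum>j=1..m. fs j * \<tau> j)) xstar"
      by (auto simp: sos_deg_def intro: peval_sos_nonneg)
    moreover have "0 \<le> peval (fs j * \<tau> j) xstar" if "j \<in> {1..m}" for j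
    proof -
      have "\<tau> j \<in> sos" using \<tau> that by (fastforce simp: sos_supp_def sos_def)
      then show ?thesis using feas[of j] that by (simp add: peval_mult peval_sos_nonneg)
    qed
    then have "0 \<le> (\<Sum>j=1..m. peval (fs j * \<tau> j) xstar)" by (rule sum_nonneg)
    ultimately have le: "\<rho> \<le> fstar + \<epsilon> * peval (Theta r b) xstar"
      using assms(2) by (simp add: peval_hom)
    \<comment> \<open>The choice of \<open>b\<close> puts \<open>xstar\<close> in the box, so each
      of the \<open>n\<close> powers in \<open>Theta\<close> is at most 1 there.\<close>
    have "(xstar $ i / b) ^ (2 * r) \<le> 1" for i
    proof -
      have "(xstar $ i / b)\<^sup>2 \<le> 1" using xb[of i] b by (simp add: abs_square_le_1)
      then show ?thesis using power_le_one[OF zero_le_power2] by (simp add: power_mult)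
    qed
    then have "peval (Theta r b) xstar \<le> 1 + (\<Sum>i\<in>(UNIV::'n set). 1)"
      unfolding peval_Theta by (intro add_left_mono sum_mono)
    then have "\<epsilon> * peval (Theta r b) xstar \<le> \<epsilon> * (real CARD('n) + 1)"
      using assms(4) by (intro mult_left_mono) auto
    with le show "x \<le> ereal (fstar + \<epsilon> * (real CARD('n) + 1))"
      by (simp add: x)
  qed
  have "k \<le> r" by (simp add: r_def)
  with k lower upper show ?thesis by blast
qed

end
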